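(* Let $\mathcal{L}$ be a finite meet-semilattice, and for every building set $\mathcal{G}$ of $\mathcal{L}$ define $\chi_{\mathcal{G}}:N(\mathcal{G})\to\mathbb{N}$ by $\chi_{\mathcal{G}}(S)=|\max N(\mathcal{G})_{\ge S}|$, the number of maximal elements (under inclusion) of $\{T\in N(\mathcal{G}): T\supseteq S\}$. Then $(\chi_{\mathcal{G}})_{\mathcal{G}}$ is an $N$-function: whenever $\mathcal{G}_1$ and $\mathcal{G}_2=\mathcal{G}_1\cup\{b\}$ with $b\notin\mathcal{G}_1$ are building sets, writing $F=F_{\mathcal{G}_1}(b)$, for every $S\in N(\mathcal{G}_2)$: $\chi_{\mathcal{G}_2}(S)=\chi_{\mathcal{G}_1}(S)$ if $b\notin S$ and $S\cup F\notin N(\mathcal{G}_1)$; $\chi_{\mathcal{G}_2}(S)=\chi_{\mathcal{G}_1}(S)+\chi_{\mathcal{G}_1}(S\cup F)(|F\setminus S|-1)$ if $b\notin S$ and $S\cup F\in N(\mathcal{G}_1)$; $\chi_{\mathcal{G}_2}(S)=\chi_{\mathcal{G}_1}(S\setminus\{b\}\cup F)\,|F\setminus S|$ if $b\in S$.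
   Context: All posets are finite. A meet-semilattice is a finite poset in which every subset has a greatest lower bound; $\hat0$ is its least element; $\bigvee T$ is the join of $T$ when it exists; $\max X$ is the set of maximal elements of $X$; $[a,b]=\{x:a\le x\le b\}$; products of posets carry the componentwise order. A subset $\mathcal{G}\subset\mathcal{L}\setminus\{\hat0\}$ is a building set if for every $p\ne\hat0$ there is a poset isomorphism $\phi:[\hat0,p]\to\prod_{g\in F_{\mathcal{G}}(p)}[\hat0,g]$ with $\phi(g)=(\hat0,\dots,g,\dots,\hat0)$ for all $g\in F_{\mathcal{G}}(p)$, where $F_{\mathcal{G}}(p)=\max\{g\in\mathcal{G}:g\le p\}$. The nested set complex $N(\mathcal{G})$ is the set of all $S\subset\mathcal{G}$ (including $\emptyset$) such that for every $T\subset S$ with $|T|\ge2$ of pairwise incomparable elements, $\bigvee T$ exists and $\bigvee T\notin\mathcal{G}$; it is ordered by inclusion. *)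

theory Defs
  imports "HOL-Library.FuncSet" "HOL-Library.Lub_Glb"
begin

text \<open>
  A finite (nonempty) meet-semilattice is a type of sort
  \<open>{finite, semilattice_inf, order_bot}\<close>: binary meets give meets of all nonempty finite
  subsets. The meet of all elements is a least element, so asking for \<open>bot\<close> is no further
  restriction. No top element is assumed, so joins need not exist; \<open>isLub UNIV T j\<close> says that
  the join of \<open>T\<close> exists and equals \<open>j\<close>.
\<close>

definition maximal_elements :: "'b::order set \<Rightarrow> 'b set" where
  "maximal_elements X = {x \<in> X. \<not> (\<exists>y\<in>X. x < y)}"

definition poset_iso :: "('b::order \<Rightarrow> 'c::order) \<Rightarrow> 'b set \<Rightarrow> 'c set \<Rightarrow> bool" where
  "poset_iso \<phi> A B \<longleftrightarrow> bij_betw \<phi> A B \<and> (\<forall>x\<in>A. \<forall>y\<in>A. x \<le> y \<longleftrightarrow> \<phi> x \<le> \<phi> y)"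

definition factors :: "'a::order set \<Rightarrow> 'a \<Rightarrow> 'a set" where
  "factors G p = maximal_elements {g \<in> G. g \<le> p}"

text \<open>
  The product of the intervals \<open>[bot, g]\<close> over \<open>g \<in> factors G p\<close> is the set of extensional
  functions on \<open>factors G p\<close>. These all agree outside \<open>factors G p\<close>, so the pointwise order of
  the function type is the componentwise order of the product.
\<close>

definition building_set :: "'a::{finite, semilattice_inf, order_bot} set \<Rightarrow> bool" where
  "building_set G \<longleftrightarrow> bot \<notin> G \<and>
     (\<forall>p. p \<noteq> bot \<longrightarrow>
       (\<exists>\<phi>. poset_iso \<phi> {bot..p} (\<Pi>\<^sub>E g\<in>factors G p. {bot..g}) \<and>
            (\<forall>g\<in>factors G p. \<phi> g = (\<lambda>h\<in>factors G p. if h = g then g else bot))))"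

definition nested_set_complex :: "'a::{finite, semilattice_inf, order_bot} set \<Rightarrow> 'a set set" where
  "nested_set_complex G =
     {S. S \<subseteq> G \<and>
         (\<forall>T\<subseteq>S. card T \<ge> 2 \<and> (\<forall>x\<in>T. \<forall>y\<in>T. x \<noteq> y \<longrightarrow> \<not> x \<le> y) \<longrightarrow>
            (\<exists>j. isLub UNIV T j \<and> j \<notin> G))}"

definition chi :: "'a::{finite, semilattice_inf, order_bot} set \<Rightarrow> 'a set \<Rightarrow> nat" where
  "chi G S = card (maximal_elements {T \<in> nested_set_complex G. S \<subseteq> T})"

text \<open>
  A family \<open>f\<close> assigns to each building set \<open>G\<close> a function \<open>f G\<close> on \<open>nested_set_complex G\<close>; its
  other values are irrelevant, since for building sets \<open>G1\<close> and \<open>G2\<close> as below every argument of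
  \<open>f G1\<close> is a nested set of \<open>G1\<close>. The second equation is read in the integers to avoid truncated
  subtraction.
\<close>

definition N_function ::
  "('a::{finite, semilattice_inf, order_bot} set \<Rightarrow> 'a set \<Rightarrow> nat) \<Rightarrow> bool" where
  "N_function f \<longleftrightarrow>
     (\<forall>G1 G2 b. building_set G1 \<and> building_set G2 \<and> b \<notin> G1 \<and> G2 = G1 \<union> {b} \<longrightarrow>
       (\<forall>S\<in>nested_set_complex G2.
          let F = factors G1 b in
            (b \<notin> S \<and> S \<union> F \<notin> nested_set_complex G1 \<longrightarrow> f G2 S = f G1 S) \<and>
            (b \<notin> S \<and> S \<union> F \<in> nested_set_complex G1 \<longrightarrow>
               int (f G2 S) = int (f G1 S) + int (f G1 (S \<union> F)) * (int (card (F - S)) - 1)) \<and>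
            (b \<in> S \<longrightarrow> f G2 S = f G1 (S - {b} \<union> F) * card (F - S))))"

end

theory Submission
  imports Defs
begin

text \<open>
  Passing from \<open>G1\<close> to \<open>G2\<close> performs the stellar subdivision of the nested set complex at
  the face \<open>F\<close>, with new vertex \<open>b\<close>. The point is that a nested antichain is recovered from
  its join as the set of factors of that join, so \<open>F\<close> is the only nested antichain with
  join \<open>b\<close>. The facets of the subdivision are the facets not containing \<open>F\<close> and, for each
  facet \<open>M\<close> containing \<open>F\<close> and each \<open>f \<in> F\<close>, the set \<open>M - {f} \<union> {b}\<close>; counting those that
  contain \<open>S\<close> gives the three equations.
\<close>

section \<open>Stellar subdivisions\<close>

text \<open>The condition \<open>S \<union> F \<in> K\<close> puts \<open>S\<close> in the closed
  star of \<open>F\<close>, and \<open>\<not> F \<subseteq> S\<close> takes away the open star, so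
  the second family is the cone with apex \<open>b\<close> over what is left of the star.\<close>

definition stellar_subdivision :: "'a set \<Rightarrow> 'a \<Rightarrow> 'a set set \<Rightarrow> 'a set set" where
  "stellar_subdivision F b K =
     {S \<in> K. \<not> F \<subseteq> S} \<union> {insert b S | S. \<not> F \<subseteq> S \<and> b \<notin> S \<and> S \<union> F \<in> K}"

text \<open>Everything above a set containing \<open>S\<close> contains \<open>S\<close> itself, so
  the restriction does not affect maximality. Hence \<open>chi\<close> counts the facets that
  contain \<open>S\<close>.\<close>

lemma maximal_elements_superset:
  "maximal_elements {T \<in> K. S \<subseteq> T} = {M \<in> maximal_elements K. S \<subseteq> M}"
proof (intro equalityI subsetI)
  fix M assume M: "M \<in> maximal_elements {T \<in> K. S \<subseteq> T}"
  have "\<not> M \<subset> T" if "T \<in> K" for T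
  proof
    assume "M \<subset> T"
    then have "T \<in> {T \<in> K. S \<subseteq> T}"
      using that M by (auto simp: maximal_elements_def)
    then show False
      using M \<open>M \<subset> T\<close> unfolding maximal_elements_def by blast
  qed
  then show "M \<in> {M \<in> maximal_elements K. S \<subseteq> M}"
    using M unfolding maximal_elements_def by blast
qed (auto simp: maximal_elements_def)

lemma maximal_elementsD:
  assumes "M \<in> maximal_elements K" "T \<in> K" "M \<le> T"
  shows "T = M"
  using assms unfolding maximal_elements_def by (auto simp: less_le)

lemma ex_facet_superset:
  fixes K :: "'a::finite set set"
  assumes "S \<in> K"
  obtains M where "M \<in> maximal_elements K" "S \<subseteq> M"
proof -
  obtain M where "M \<in> K" "S \<subseteq> M" "\<forall>T\<in>K. M \<subseteq> T \<longrightarrow> M = T"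
    using finite_has_maximal2[OF _ assms] by auto
  then have "M \<in> maximal_elements K"
    by (auto simp: maximal_elements_def)
  then show thesis
    using that \<open>S \<subseteq> M\<close> by blast
qed

section \<open>Facets of a stellar subdivision\<close>

context
  fixes F :: "'a::finite set" and b :: 'a and K :: "'a set set"
  assumes down: "\<forall>S\<in>K. \<forall>T\<subseteq>S. T \<in> K"
    and new: "\<forall>S\<in>K. b \<notin> S"
    and b_notin: "b \<notin> F"
begin

lemma insert_in_stellar_subdivision:
  "b \<notin> S \<Longrightarrow> insert b S \<in> stellar_subdivision F b K \<longleftrightarrow> \<not> F \<subseteq> S \<and> S \<union> F \<in> K"
  unfolding stellar_subdivision_def using new by (auto simp: insert_ident)

lemma in_stellar_subdivision:
  "b \<notin> S \<Longrightarrow> S \<in> stellar_subdivision F b K \<longleftrightarrow> S \<in> K \<and> \<not> F \<subseteq> S"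
  unfolding stellar_subdivision_def by auto

text \<open>If \<open>b\<close> cannot be added to \<open>M\<close>, then
  \<open>M \<union> F\<close> is not a face of \<open>K\<close>, so every face of \<open>K\<close>
  above \<open>M\<close> avoids \<open>F\<close> and survives the subdivision. Conversely, a face
  above \<open>M\<close> that contains \<open>b\<close> would make \<open>M \<union> F\<close> a
  face of \<open>K\<close>, and maximality of \<open>M\<close> would force
  \<open>F \<subseteq> M\<close>.\<close>

lemma facet_stellar_subdivision_old:
  assumes "b \<notin> M"
  shows "M \<in> maximal_elements (stellar_subdivision F b K) \<longleftrightarrow>
    M \<in> maximal_elements K \<and> \<not> F \<subseteq> M"
proof
  assume M: "M \<in> maximal_elements (stellar_subdivision F b K)"
  then have MK: "M \<in> K" "\<not> F \<subseteq> M"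
    using assms in_stellar_subdivision by (auto simp: maximal_elements_def)
  have noF: "M \<union> F \<notin> K"
  proof
    assume "M \<union> F \<in> K"
    then have "insert b M \<in> stellar_subdivision F b K"
      using MK assms insert_in_stellar_subdivision by blast
    then show False
      using maximal_elementsD[OF M] assms by blast
  qed
  have "\<not> M \<subset> T" if "T \<in> K" for T
  proof
    assume "M \<subset> T"
    moreover have "\<not> F \<subseteq> T"
      using noF down[rule_format, OF that, of "M \<union> F"] \<open>M \<subset> T\<close> by blast
    then have "T \<in> stellar_subdivision F b K"
      using that new in_stellar_subdivision by blast
    ultimately show False
      using maximal_elementsD[OF M] by blast
  qed
  then show "M \<in> maximal_elements K \<and> \<not> F \<subseteq> M"
    using MK by (auto simp: maximal_elements_def)
next
  assume M: "M \<in> maximal_elements K \<and> \<not> F \<subseteq> M"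
  then have MK: "M \<in> K"
    by (auto simp: maximal_elements_def)
  have "\<not> M \<subset> T" if T: "T \<in> stellar_subdivision F b K" for T
  proof
    assume MT: "M \<subset> T"
    show False
    proof (cases "b \<in> T")
      case True
      then have "(T - {b}) \<union> F \<in> K"
        using insert_in_stellar_subdivision[of "T - {b}"] T by (simp add: insert_absorb)
      then have "(T - {b}) \<union> F = M"
        using maximal_elementsD[of M K] M MT assms by blast
      then show False
        using M by blast
    next
      case False
      then show False
        using T MT M maximal_elementsD[of M K T] in_stellar_subdivision by blast
    qed
  qed
  then show "M \<in> maximal_elements (stellar_subdivision F b K)"
    using M MK assms in_stellar_subdivision by (auto simp: maximal_elements_def)
qed

text \<open>Removing \<open>b\<close> from \<open>N\<close> and adding \<open>F\<close> gives a face
  of \<open>K\<close>, which lies in a facet \<open>M\<close>. Some \<open>f \<in> F\<close> is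
  missing from \<open>N\<close>, and \<open>insert b (M - {f})\<close> is a face above
  \<open>N\<close>, hence equal to it. Conversely, a larger face would, after the same exchange,
  give back \<open>M\<close>; since it cannot contain all of \<open>F\<close>, it still misses
  \<open>f\<close>.\<close>

lemma facet_stellar_subdivision_new:
  assumes "b \<in> N"
  shows "N \<in> maximal_elements (stellar_subdivision F b K) \<longleftrightarrow>
    (\<exists>M f. M \<in> maximal_elements K \<and> F \<subseteq> M \<and> f \<in> F \<and> N = insert b (M - {f}))"
proof
  assume N: "N \<in> maximal_elements (stellar_subdivision F b K)"
  define T where "T = N - {b}"
  have NT: "N = insert b T" "b \<notin> T"
    using assms by (auto simp: T_def)
  have T: "\<not> F \<subseteq> T" "T \<union> F \<in> K"
    using N NT insert_in_stellar_subdivision by (auto simp: maximal_elements_def)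
  then obtain M where M: "M \<in> maximal_elements K" "T \<union> F \<subseteq> M"
    using ex_facet_superset by metis
  obtain f where f: "f \<in> F" "f \<notin> T"
    using T by blast
  have MK: "M \<in> K"
    using M by (simp add: maximal_elements_def)
  have "M - {f} \<union> F = M"
    using M f by blast
  then have "insert b (M - {f}) \<in> stellar_subdivision F b K"
    using insert_in_stellar_subdivision[of "M - {f}"] MK bspec[OF new MK] f by auto
  then have "insert b (M - {f}) = N"
    using maximal_elementsD[OF N] NT M f by blast
  then show "\<exists>M f. M \<in> maximal_elements K \<and> F \<subseteq> M \<and> f \<in> F \<and> N = insert b (M - {f})"
    using M f by blast
next
  assume "\<exists>M f. M \<in> maximal_elements K \<and> F \<subseteq> M \<and> f \<in> F \<and> N = insert b (M - {f})"
  then obtain M f where M: "M \<in> maximal_elements K" "F \<subseteq> M" "f \<in> F" "N = insert b (M - {f})"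
    by blast
  have MK: "M \<in> K"
    using M by (simp add: maximal_elements_def)
  have "M - {f} \<union> F = M"
    using M by blast
  then have N: "N \<in> stellar_subdivision F b K"
    using insert_in_stellar_subdivision[of "M - {f}"] MK bspec[OF new MK] M by auto
  have "\<not> N \<subset> T" if T: "T \<in> stellar_subdivision F b K" for T
  proof
    assume NT: "N \<subset> T"
    then have "b \<in> T"
      using M by blast
    then have TF: "\<not> F \<subseteq> T - {b}" "(T - {b}) \<union> F \<in> K"
      using insert_in_stellar_subdivision[of "T - {b}"] T by (simp_all add: insert_absorb)
    have "M \<subseteq> (T - {b}) \<union> F"
      using M NT bspec[OF new MK] by blast
    then have TM: "(T - {b}) \<union> F = M"
      using maximal_elementsD[OF M(1) TF(2)] by blast
    have "M - {f} \<subseteq> T"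
      using NT M(4) by blast
    then have "f \<notin> T"
      using TF(1) M(2) b_notin by blast
    then have "T \<subseteq> N"
      using TM M(4) by blast
    then show False
      using NT by blast
  qed
  then show "N \<in> maximal_elements (stellar_subdivision F b K)"
    using N by (auto simp: maximal_elements_def)
qed

section \<open>Counting the facets above a given face\<close>

text \<open>The pair \<open>(M, f)\<close> can be read off from the facet: \<open>f\<close> is the
  only element of \<open>F\<close> that it misses, and \<open>M\<close> arises by exchanging
  \<open>b\<close> for \<open>f\<close>. The facet contains \<open>S\<close> exactly when
  \<open>M\<close> does and \<open>f\<close> is outside \<open>S\<close>.\<close>

lemma card_new_facets:
  assumes "b \<notin> S"
  shows "card {N \<in> maximal_elements (stellar_subdivision F b K). b \<in> N \<and> S \<subseteq> N} =
    card {M \<in> maximal_elements K. S \<union> F \<subseteq> M} * card (F - S)"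
proof -
  let ?h = "\<lambda>(M, f). insert b (M - {f})"
  let ?P = "{M \<in> maximal_elements K. S \<union> F \<subseteq> M} \<times> (F - S)"
  have eq: "{N \<in> maximal_elements (stellar_subdivision F b K). b \<in> N \<and> S \<subseteq> N} = ?h ` ?P"
  proof (intro equalityI subsetI)
    fix N assume "N \<in> {N \<in> maximal_elements (stellar_subdivision F b K). b \<in> N \<and> S \<subseteq> N}"
    then obtain M f where M: "M \<in> maximal_elements K" "F \<subseteq> M" "f \<in> F" "N = insert b (M - {f})"
      "S \<subseteq> N"
      using facet_stellar_subdivision_new by blast
    then have "(M, f) \<in> ?P"
      using assms b_notin by auto
    then show "N \<in> ?h ` ?P"
      using M by (intro image_eqI[of _ _ "(M, f)"]) auto
  next
    fix N assume "N \<in> ?h ` ?P"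
    then show "N \<in> {N \<in> maximal_elements (stellar_subdivision F b K). b \<in> N \<and> S \<subseteq> N}"
      using facet_stellar_subdivision_new by auto
  qed
  have "inj_on ?h ?P"
  proof (rule inj_onI, clarify)
    fix M f M' f'
    assume *: "insert b (M - {f}) = insert b (M' - {f'})"
      "M \<in> maximal_elements K" "M' \<in> maximal_elements K"
      "S \<union> F \<subseteq> M" "S \<union> F \<subseteq> M'" "f \<in> F" "f' \<in> F"
    have "b \<notin> M" "b \<notin> M'"
      using * new by (auto simp: maximal_elements_def)
    then have eq: "M - {f} = M' - {f'}"
      using *(1) by (subst (asm) insert_ident) auto
    have f: "f \<in> M" "f \<in> M'" "f' \<in> M'"
      using *(4-7) by auto
    \<comment> \<open>\<open>f\<close> lies in \<open>M'\<close> but not in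
      \<open>M' - {f'}\<close>, because that set equals \<open>M - {f}\<close>.\<close>
    have "f = f'"
      using eq f by blast
    then show "M = M' \<and> f = f'"
      using eq f by blast
  qed
  then show ?thesis
    unfolding eq by (simp only: card_image card_cartesian_product)
qed

text \<open>The facets of \<open>K\<close> above \<open>S\<close> split into those that avoid
  \<open>F\<close>, which survive, and those that contain \<open>F\<close>. Stating this as a sum
  avoids subtraction of natural numbers.\<close>

lemma card_old_facets:
  assumes "b \<notin> S"
  shows "card {N \<in> maximal_elements (stellar_subdivision F b K). b \<notin> N \<and> S \<subseteq> N} +
    card {M \<in> maximal_elements K. S \<union> F \<subseteq> M} = card {M \<in> maximal_elements K. S \<subseteq> M}"
proof -
  have "b \<notin> M" if "M \<in> maximal_elements K" for M
    using that new by (simp add: maximal_elements_def)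
  then have "{N \<in> maximal_elements (stellar_subdivision F b K). b \<notin> N \<and> S \<subseteq> N} =
    {M \<in> maximal_elements K. S \<subseteq> M \<and> \<not> F \<subseteq> M}"
    using facet_stellar_subdivision_old by blast
  moreover have "{M \<in> maximal_elements K. S \<subseteq> M} =
    {M \<in> maximal_elements K. S \<subseteq> M \<and> \<not> F \<subseteq> M} \<union> {M \<in> maximal_elements K. S \<union> F \<subseteq> M}"
    by auto
  moreover have "{M \<in> maximal_elements K. S \<subseteq> M \<and> \<not> F \<subseteq> M} \<inter>
      {M \<in> maximal_elements K. S \<union> F \<subseteq> M} = {}"
    by auto
  ultimately show ?thesis
    by (simp add: card_Un_disjoint)
qed

end

section \<open>Factors and nested antichains\<close>

lemma isLub_UNIV_iff:
  "isLub UNIV T j \<longleftrightarrow> (\<forall>t\<in>T. t \<le> j) \<and> (\<forall>u. (\<forall>t\<in>T. t \<le> u) \<longrightarrow> j \<le> u)"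
  by (auto simp: isLub_def isUb_def leastP_def setle_def setge_def)

lemma isLub_UNIV_unique:
  fixes p q :: "'a::order"
  assumes "isLub UNIV T p" "isLub UNIV T q"
  shows "p = q"
  using assms by (meson isLub_UNIV_iff order.antisym)

lemma isLub_empty:
  fixes p :: "'a::order_bot"
  assumes "isLub UNIV {} p"
  shows "p = bot"
  using assms bot_unique unfolding isLub_UNIV_iff by blast

text \<open>The join is the meet of the upper bounds, a finite set that is nonempty because it
  contains \<open>u\<close>.\<close>

lemma ex_isLub_bounded:
  fixes u :: "'a::{finite, semilattice_inf}"
  assumes "\<And>t. t \<in> T \<Longrightarrow> t \<le> u"
  shows "\<exists>j. isLub UNIV T j"
proof -
  let ?U = "{v. \<forall>t\<in>T. t \<le> v}"
  have "?U \<noteq> {}"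
    using assms by blast
  then have "isLub UNIV T (Inf_fin ?U)"
    unfolding isLub_UNIV_iff by (auto intro!: Inf_fin.boundedI Inf_fin.coboundedI)
  then show ?thesis ..
qed

section \<open>Factors and the product decomposition of lower intervals\<close>

lemma factorsD:
  assumes "g \<in> factors G p"
  shows "g \<in> G" "g \<le> p"
  using assms by (auto simp: factors_def maximal_elements_def)

lemma factors_antichain:
  assumes "g \<in> factors G p" "h \<in> factors G p" "g \<le> h"
  shows "g = h"
  using assms by (auto simp: factors_def maximal_elements_def order.order_iff_strict)

lemma le_factor:
  fixes k :: "'a::{finite, order}"
  assumes "k \<in> G" "k \<le> p"
  obtains g where "g \<in> factors G p" "k \<le> g"
proof -
  obtain g where "g \<in> {g \<in> G. g \<le> p}" "k \<le> g" "\<forall>h\<in>{g \<in> G. g \<le> p}. g \<le> h \<longrightarrow> g = h"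
    using finite_has_maximal2[of "{g \<in> G. g \<le> p}" k] assms by auto
  then have "g \<in> factors G p"
    unfolding factors_def maximal_elements_def by auto
  with \<open>k \<le> g\<close> show thesis
    using that by blast
qed

lemma building_set_bot: "building_set G \<Longrightarrow> bot \<notin> G"
  by (simp add: building_set_def)

lemma building_setE:
  fixes G :: "'a::{finite, semilattice_inf, order_bot} set"
  assumes "building_set G" "p \<noteq> bot"
  obtains \<phi> where "\<And>x y. x \<le> p \<Longrightarrow> y \<le> p \<Longrightarrow> x \<le> y \<longleftrightarrow> \<phi> x \<le> \<phi> y"
    and "\<And>x. x \<le> p \<Longrightarrow> \<phi> x \<in> (\<Pi>\<^sub>E g\<in>factors G p. {bot..g})"
    and "\<And>z. z \<in> (\<Pi>\<^sub>E g\<in>factors G p. {bot..g}) \<Longrightarrow> \<exists>w\<le>p. \<phi> w = z"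
    and "\<And>g. g \<in> factors G p \<Longrightarrow> \<phi> g = (\<lambda>h\<in>factors G p. if h = g then g else bot)"
proof -
  obtain \<phi> where iso: "poset_iso \<phi> {bot..p} (\<Pi>\<^sub>E g\<in>factors G p. {bot..g})"
    and g: "\<forall>g\<in>factors G p. \<phi> g = (\<lambda>h\<in>factors G p. if h = g then g else bot)"
    using assms unfolding building_set_def by blast
  have im: "\<phi> ` {bot..p} = (\<Pi>\<^sub>E g\<in>factors G p. {bot..g})"
    using iso by (simp add: poset_iso_def bij_betw_def)
  show thesis
  proof (rule that)
    show "x \<le> y \<longleftrightarrow> \<phi> x \<le> \<phi> y" if "x \<le> p" "y \<le> p" for x y
      using iso that by (simp add: poset_iso_def)
    show "\<phi> x \<in> (\<Pi>\<^sub>E g\<in>factors G p. {bot..g})" if "x \<le> p" for x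
      using im that by auto
    show "\<exists>w\<le>p. \<phi> w = z" if "z \<in> (\<Pi>\<^sub>E g\<in>factors G p. {bot..g})" for z
      using that unfolding im[symmetric] by auto
    show "\<phi> g = (\<lambda>h\<in>factors G p. if h = g then g else bot)" if "g \<in> factors G p" for g
      using g that by blast
  qed
qed

text \<open>For an upper bound \<open>u\<close> of the factors, compare \<open>p\<close> with
  \<open>inf u p\<close> coordinatewise. The coordinate of \<open>p\<close> at \<open>g\<close> is
  at most \<open>g\<close>, while that of \<open>inf u p\<close> is at least \<open>g\<close>
  because \<open>inf u p\<close> lies above \<open>g\<close>. Hence
  \<open>p \<le> inf u p\<close>.\<close>

lemma isLub_factors:
  fixes G :: "'a::{finite, semilattice_inf, order_bot} set"
  assumes "building_set G" "p \<noteq> bot"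
  shows "isLub UNIV (factors G p) p"
  unfolding isLub_UNIV_iff
proof (intro conjI ballI allI impI)
  fix u assume u: "\<forall>g\<in>factors G p. g \<le> u"
  obtain \<phi> where ord: "\<And>x y. x \<le> p \<Longrightarrow> y \<le> p \<Longrightarrow> x \<le> y \<longleftrightarrow> \<phi> x \<le> \<phi> y"
    and im: "\<And>x. x \<le> p \<Longrightarrow> \<phi> x \<in> (\<Pi>\<^sub>E g\<in>factors G p. {bot..g})"
    and unit: "\<And>g. g \<in> factors G p \<Longrightarrow> \<phi> g = (\<lambda>h\<in>factors G p. if h = g then g else bot)"
    by (rule building_setE[OF assms]) blast
  have "\<phi> p \<le> \<phi> (inf u p)"
  proof (rule le_funI)
    fix g show "\<phi> p g \<le> \<phi> (inf u p) g"
    proof (cases "g \<in> factors G p")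
      case True
      then have "\<phi> g \<le> \<phi> (inf u p)"
        using ord[of g "inf u p"] u by (simp add: factorsD)
      then have "g \<le> \<phi> (inf u p) g"
        using unit[OF True] True by (auto dest: le_funD[of _ _ g])
      moreover have "\<phi> p g \<le> g"
        using im[of p] True by auto
      ultimately show ?thesis
        by (rule order.trans[rotated])
    next
      case False
      then show ?thesis
        using im[of p] im[of "inf u p"] by (simp add: PiE_def extensional_def)
    qed
  qed
  then show "p \<le> u"
    using ord[of p "inf u p"] by simp
qed (rule factorsD)

text \<open>Joins in a product are computed componentwise, and each element of \<open>T\<close> lies
  below a single factor. So only the elements below \<open>g\<close> contribute to coordinate
  \<open>g\<close> of \<open>p\<close>: a smaller bound for them would yield a smaller bound for all
  of \<open>T\<close>.\<close>

lemma isLub_below_factor: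
  fixes G :: "'a::{finite, semilattice_inf, order_bot} set"
  assumes "building_set G" "p \<noteq> bot" and T: "T \<subseteq> G" "isLub UNIV T p" and g: "g \<in> factors G p"
  shows "isLub UNIV {t \<in> T. t \<le> g} g"
  unfolding isLub_UNIV_iff
proof (intro conjI ballI allI impI)
  fix v assume v: "\<forall>t\<in>{t \<in> T. t \<le> g}. t \<le> v"
  \<comment> \<open>Meeting with \<open>g\<close> brings the bound \<open>v\<close> into the
    interval below \<open>p\<close>, where \<open>\<phi>\<close> is controlled.\<close>
  define u where "u = inf v g"
  have up: "u \<le> p" and gp: "g \<le> p"
    using factorsD[OF g] by (auto simp: u_def intro: le_infI2)
  obtain \<phi> where ord: "\<And>x y. x \<le> p \<Longrightarrow> y \<le> p \<Longrightarrow> x \<le> y \<longleftrightarrow> \<phi> x \<le> \<phi> y"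
    and im: "\<And>x. x \<le> p \<Longrightarrow> \<phi> x \<in> (\<Pi>\<^sub>E g\<in>factors G p. {bot..g})"
    and surj: "\<And>z. z \<in> (\<Pi>\<^sub>E g\<in>factors G p. {bot..g}) \<Longrightarrow> \<exists>w\<le>p. \<phi> w = z"
    and unit: "\<And>g. g \<in> factors G p \<Longrightarrow> \<phi> g = (\<lambda>h\<in>factors G p. if h = g then g else bot)"
    by (rule building_setE[OF assms(1,2)]) blast
  \<comment> \<open>Only coordinate \<open>g\<close> of \<open>p\<close> is lowered, to that of
    \<open>u\<close>. The preimage \<open>w\<close> of this tuple still bounds \<open>T\<close>, so
    \<open>g \<le> p \<le> w\<close>, and reading off coordinate \<open>g\<close> gives
    \<open>g \<le> \<phi> u g\<close>.\<close>
  define z where "z = (\<phi> p)(g := \<phi> u g)"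
  have "z \<in> (\<Pi>\<^sub>E g\<in>factors G p. {bot..g})"
    using im[of p] im[OF up] g by (auto simp: z_def PiE_def Pi_def extensional_def)
  then obtain w where w: "w \<le> p" "\<phi> w = z"
    using surj by blast
  have "t \<le> w" if t: "t \<in> T" for t
  proof -
    have tp: "t \<le> p"
      using T t by (auto simp: isLub_UNIV_iff)
    have "\<phi> t g \<le> \<phi> u g"
    proof (cases "t \<le> g")
      case True
      then have "t \<le> u"
        using v t by (simp add: u_def)
      then show ?thesis
        using ord[OF tp up] by (simp add: le_fun_def)
    next
      case False
      \<comment> \<open>The factor above \<open>t\<close> differs from \<open>g\<close>, so
        \<open>t\<close> has coordinate \<open>bot\<close> at \<open>g\<close>.\<close>
      obtain h where h: "h \<in> factors G p" "t \<le> h"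
        using le_factor[of t G p] T t tp by blast
      then have "\<phi> t \<le> \<phi> h"
        using ord tp factorsD by blast
      moreover have "\<phi> h g = bot"
        using unit[OF h(1)] g False h by auto
      ultimately have "\<phi> t g \<le> bot"
        by (metis le_funD)
      then show ?thesis
        by (simp add: bot_unique)
    qed
    moreover have "\<phi> t \<le> \<phi> p"
      using ord tp by blast
    ultimately have "\<phi> t \<le> \<phi> w"
      unfolding w z_def by (simp add: le_fun_def)
    then show ?thesis
      using ord tp w by blast
  qed
  then have "g \<le> w"
    using T gp by (meson isLub_UNIV_iff order.trans)
  then have "\<phi> g \<le> z"
    using ord gp w by blast
  then have *: "g \<le> \<phi> u g"
    using le_funD[of "\<phi> g" z g] unit[OF g] g by (simp add: z_def)
  \<comment> \<open>At every factor other than \<open>g\<close> the coordinate of \<open>g\<close>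
    is \<open>bot\<close>, so coordinate \<open>g\<close> decides.\<close>
  have "\<phi> g \<le> \<phi> u"
  proof (rule le_funI)
    fix h show "\<phi> g h \<le> \<phi> u h"
      using unit[OF g] * im[OF up] by (auto simp: PiE_def extensional_def)
  qed
  then have "g \<le> u"
    using ord gp up by blast
  then show "g \<le> v"
    by (simp add: u_def)
qed auto

lemma factors_single:
  assumes "g \<in> G"
  shows "factors G g = {g}"
  using assms by (auto simp: factors_def maximal_elements_def order.order_iff_strict)

section \<open>Nested sets and joins of their antichains\<close>

lemma nested_setI:
  assumes "S \<subseteq> G"
    and "\<And>T. T \<subseteq> S \<Longrightarrow> 2 \<le> card T \<Longrightarrow> (\<And>x y. x \<in> T \<Longrightarrow> y \<in> T \<Longrightarrow> x \<le> y \<Longrightarrow> x = y) \<Longrightarrow>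
      \<exists>j. isLub UNIV T j \<and> j \<notin> G"
  shows "S \<in> nested_set_complex G"
  unfolding nested_set_complex_def
proof (intro CollectI conjI allI impI)
  fix T assume "T \<subseteq> S" "2 \<le> card T \<and> (\<forall>x\<in>T. \<forall>y\<in>T. x \<noteq> y \<longrightarrow> \<not> x \<le> y)"
  then show "\<exists>j. isLub UNIV T j \<and> j \<notin> G"
    by (intro assms(2)) auto
qed (rule assms(1))

lemma nested_setD:
  assumes "S \<in> nested_set_complex G" "T \<subseteq> S" "2 \<le> card T"
    and "\<And>x y. x \<in> T \<Longrightarrow> y \<in> T \<Longrightarrow> x \<le> y \<Longrightarrow> x = y"
  shows "\<exists>j. isLub UNIV T j \<and> j \<notin> G"
proof -
  have "\<forall>x\<in>T. \<forall>y\<in>T. x \<noteq> y \<longrightarrow> \<not> x \<le> y"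
    using assms(4) by blast
  then show ?thesis
    using assms(1-3) by (simp add: nested_set_complex_def)
qed

lemma nested_subset:
  assumes "S \<in> nested_set_complex G" "T \<subseteq> S"
  shows "T \<in> nested_set_complex G"
proof (rule nested_setI)
  show "T \<subseteq> G"
    using assms by (auto simp: nested_set_complex_def)
  show "\<exists>j. isLub UNIV U j \<and> j \<notin> G"
    if "U \<subseteq> T" "2 \<le> card U" "\<And>x y. x \<in> U \<Longrightarrow> y \<in> U \<Longrightarrow> x \<le> y \<Longrightarrow> x = y" for U
    by (rule nested_setD[OF assms(1) order.trans[OF that(1) assms(2)] that(2,3)])
qed

lemma nested_set_subset: "S \<in> nested_set_complex G \<Longrightarrow> S \<subseteq> G"
  by (simp add: nested_set_complex_def)

lemma card_ge_2I:
  fixes T :: "'a::finite set"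
  assumes "x \<in> T" "y \<in> T" "x \<noteq> y"
  shows "card T \<ge> 2"
  using card_mono[of T "{x, y}"] assms by simp

lemma nested_isLub:
  fixes G :: "'a::{finite, semilattice_inf, order_bot} set"
  assumes "S \<in> nested_set_complex G" "T \<subseteq> S" "x \<in> T" "y \<in> T" "x \<noteq> y"
    and "\<And>x y. x \<in> T \<Longrightarrow> y \<in> T \<Longrightarrow> x \<le> y \<Longrightarrow> x = y"
  shows "\<exists>j. isLub UNIV T j \<and> j \<notin> G"
  by (rule nested_setD[OF assms(1,2) card_ge_2I[OF assms(3-5)] assms(6)])

text \<open>Below each factor \<open>g\<close> of \<open>p\<close> the elements of \<open>T\<close>
  have join \<open>g\<close>. There is at least one, since the empty join is \<open>bot\<close>, and
  at most one, since two or more would form a nested antichain with join in \<open>G\<close>. So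
  \<open>g\<close> itself is the element of \<open>T\<close> below \<open>g\<close>, and every
  element of \<open>T\<close> lies below some factor.\<close>

lemma factors_join_nested_antichain:
  fixes G :: "'a::{finite, semilattice_inf, order_bot} set"
  assumes G: "building_set G" and S: "S \<in> nested_set_complex G" and TS: "T \<subseteq> S" and "T \<noteq> {}"
    and anti: "\<And>x y. x \<in> T \<Longrightarrow> y \<in> T \<Longrightarrow> x \<le> y \<Longrightarrow> x = y"
    and lub: "isLub UNIV T p"
  shows "factors G p = T"
proof -
  have TG: "T \<subseteq> G"
    using TS nested_set_subset[OF S] by blast
  have Tp: "t \<le> p" if "t \<in> T" for t
    using lub that by (simp add: isLub_UNIV_iff)
  obtain t where "t \<in> T"
    using \<open>T \<noteq> {}\<close> by blast
  then have "t \<noteq> bot" "t \<le> p"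
    using Tp TG building_set_bot[OF G] by auto
  then have "p \<noteq> bot"
    using bot_unique by blast
  have unique: "{t \<in> T. t \<le> g} = {g}" if g: "g \<in> factors G p" for g
  proof -
    have lubg: "isLub UNIV {t \<in> T. t \<le> g} g"
      by (rule isLub_below_factor[OF G \<open>p \<noteq> bot\<close> TG lub g])
    have "g \<noteq> bot"
      using g factorsD building_set_bot[OF G] by blast
    then have "{t \<in> T. t \<le> g} \<noteq> {}"
      using lubg isLub_empty by force
    then obtain t where t: "t \<in> T" "t \<le> g"
      by blast
    have "t' = t" if "t' \<in> T" "t' \<le> g" for t'
    proof (rule ccontr)
      assume "t' \<noteq> t"
      have "\<exists>j. isLub UNIV {t \<in> T. t \<le> g} j \<and> j \<notin> G"
        by (rule nested_isLub[OF S _ _ _ \<open>t' \<noteq> t\<close>]) (use TS t that anti in auto)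
      then show False
        using isLub_UNIV_unique[OF lubg] factorsD[OF g] by blast
    qed
    then have single: "{t \<in> T. t \<le> g} = {t}"
      using t by blast
    then have "g = t"
      using lubg t by (auto simp: isLub_UNIV_iff order.antisym)
    then show ?thesis
      using single by simp
  qed
  show ?thesis
  proof (intro equalityI subsetI)
    fix t assume t: "t \<in> T"
    then obtain g where g: "g \<in> factors G p" "t \<le> g"
      using le_factor[of t G p] Tp TG by blast
    then have "t \<in> {g}"
      unfolding unique[OF g(1), symmetric] using t by simp
    then show "t \<in> factors G p"
      using g by simp
  next
    fix g assume "g \<in> factors G p"
    then have "g \<in> {t \<in> T. t \<le> g}"
      using unique by simp
    then show "g \<in> T"
      by simp
  qed
qed

section \<open>Adding one element to a building set\<close>

context
  fixes G :: "'a::{finite, semilattice_inf, order_bot} set" and b :: 'a and F :: "'a set"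
  assumes G: "building_set G" and Gb: "building_set (insert b G)" and bG: "b \<notin> G"
  defines "F \<equiv> factors G b"
begin

text \<open>\<open>b\<close> is the join of \<open>F\<close>. An empty \<open>F\<close> would give
  \<open>b = bot\<close>, and a single factor would equal \<open>b\<close> and put it in
  \<open>G\<close>.\<close>

lemma factors_new_two:
  obtains f f' where "f \<in> F" "f' \<in> F" "f \<noteq> f'"
proof -
  have "b \<noteq> bot"
    using building_set_bot[OF Gb] by auto
  then have lub: "isLub UNIV F b"
    using isLub_factors[OF G] by (simp add: F_def)
  have "F \<noteq> {}"
    using lub \<open>b \<noteq> bot\<close> isLub_empty by blast
  then obtain f where f: "f \<in> F"
    by blast
  have "F \<noteq> {f}"
  proof
    assume "F = {f}"
    then have "b = f"
      using lub by (auto simp: isLub_UNIV_iff order.antisym)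
    then show False
      using f bG factorsD unfolding F_def by blast
  qed
  then show thesis
    using that f by blast
qed

lemma isLub_factors_new: "isLub UNIV F b"
  using isLub_factors[OF G, of b] building_set_bot[OF Gb] by (auto simp: F_def)

text \<open>For sets without \<open>b\<close>, enlarging \<open>G\<close> only forbids antichains
  with join \<open>b\<close>. Within a nested set of \<open>G\<close> the only such antichain is
  \<open>F\<close>, because an antichain is the set of factors of its join.\<close>

lemma nested_insert_old:
  assumes "b \<notin> S"
  shows "S \<in> nested_set_complex (insert b G) \<longleftrightarrow> S \<in> nested_set_complex G \<and> \<not> F \<subseteq> S"
proof
  assume S: "S \<in> nested_set_complex (insert b G)"
  have "\<not> F \<subseteq> S"
  proof
    assume FS: "F \<subseteq> S"
    obtain f f' where "f \<in> F" "f' \<in> F" "f \<noteq> f'"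
      by (rule factors_new_two)
    then have "\<exists>j. isLub UNIV F j \<and> j \<notin> insert b G"
      by (intro nested_isLub[OF S FS]) (auto simp: F_def intro: factors_antichain)
    then show False
      using isLub_UNIV_unique isLub_factors_new by blast
  qed
  moreover have "S \<in> nested_set_complex G"
  proof (rule nested_setI)
    show "S \<subseteq> G"
      using nested_set_subset[OF S] assms by blast
    fix T assume "T \<subseteq> S" "2 \<le> card T" "\<And>x y. x \<in> T \<Longrightarrow> y \<in> T \<Longrightarrow> x \<le> y \<Longrightarrow> x = y"
    from nested_setD[OF S this] show "\<exists>j. isLub UNIV T j \<and> j \<notin> G"
      by blast
  qed
  ultimately show "S \<in> nested_set_complex G \<and> \<not> F \<subseteq> S"
    by blast
next
  assume S: "S \<in> nested_set_complex G \<and> \<not> F \<subseteq> S"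
  then have SG: "S \<in> nested_set_complex G" ..
  show "S \<in> nested_set_complex (insert b G)"
  proof (rule nested_setI)
    show "S \<subseteq> insert b G"
      using nested_set_subset[OF SG] by blast
    fix T assume TS: "T \<subseteq> S" and T: "2 \<le> card T"
      and anti: "\<And>x y. x \<in> T \<Longrightarrow> y \<in> T \<Longrightarrow> x \<le> y \<Longrightarrow> x = y"
    obtain j where j: "isLub UNIV T j" "j \<notin> G"
      using nested_setD[OF SG TS T anti] by blast
    have "j \<noteq> b"
    proof
      assume "j = b"
      moreover have "T \<noteq> {}"
        using T by auto
      ultimately have "F = T"
        using factors_join_nested_antichain[OF G SG TS _ anti j(1)] unfolding F_def by blast
      then show False
        using S TS by blast
    qed
    then show "\<exists>j. isLub UNIV T j \<and> j \<notin> insert b G"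
      using j by blast
  qed
qed

text \<open>The critical antichains \<open>T\<close> contain some \<open>f \<in> F\<close> outside
  \<open>S\<close>. Replacing the elements of \<open>T\<close> below \<open>b\<close> by
  \<open>b\<close> itself gives a nested antichain of \<open>insert b G\<close>, whose join
  \<open>q\<close> bounds \<open>T\<close>. So \<open>T\<close> has a join \<open>j \<le> q\<close>.
  If \<open>j\<close> were in \<open>G\<close>, it would lie below a factor of \<open>q\<close>, and
  either kind of factor leads to an element of \<open>T\<close> above \<open>j\<close>, which is
  impossible for an antichain with two elements.\<close>

lemma nested_union_factors:
  assumes "b \<notin> S" and S: "insert b S \<in> nested_set_complex (insert b G)"
  shows "S \<union> F \<in> nested_set_complex G"
proof (rule nested_setI)
  show "S \<union> F \<subseteq> G"
    using nested_set_subset[OF S] assms(1) by (auto simp: F_def dest: factorsD)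
  fix T assume TS: "T \<subseteq> S \<union> F" and T: "2 \<le> card T"
    and anti: "\<And>x y. x \<in> T \<Longrightarrow> y \<in> T \<Longrightarrow> x \<le> y \<Longrightarrow> x = y"
  have SG: "S \<in> nested_set_complex G"
    using nested_subset[OF S] nested_insert_old[OF assms(1)] by blast
  show "\<exists>j. isLub UNIV T j \<and> j \<notin> G"
  proof (cases "T \<subseteq> S")
    case True
    then show ?thesis
      using nested_setD[OF SG True T anti] by blast
  next
    case False
    then obtain f where f: "f \<in> T" "f \<in> F" "f \<notin> S"
      using TS by blast
    have fb: "f \<le> b"
      using f factorsD unfolding F_def by blast
    define A where "A = {a \<in> T. \<not> a \<le> b}"
    have AS: "A \<subseteq> S"
      using TS factorsD unfolding A_def F_def by blast
    have antiA: "x = y" if xy: "x \<in> insert b A" "y \<in> insert b A" "x \<le> y" for x y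
    proof -
      \<comment> \<open>An element of \<open>A\<close> above \<open>b\<close> would also be above
        \<open>f\<close>, which contradicts that \<open>T\<close> is an antichain.\<close>
      have "\<not> b \<le> a" if "a \<in> A" for a
      proof
        assume "b \<le> a"
        then have "f = a"
          using anti[of f a] f fb that order.trans unfolding A_def by blast
        then show False
          using that fb unfolding A_def by blast
      qed
      then show ?thesis
        using xy anti unfolding A_def by blast
    qed
    obtain q where q: "isLub UNIV (insert b A) q"
    proof (cases "A = {}")
      \<comment> \<open>Nestedness says nothing about one-element antichains, so the join of
        \<open>{b}\<close> is given directly.\<close>
      case True
      then show thesis
        using that[of b] by (simp add: isLub_UNIV_iff)
    next
      case False
      then obtain a where "a \<in> A" "a \<noteq> b"
        unfolding A_def by blast
      then have "\<exists>j. isLub UNIV (insert b A) j \<and> j \<notin> insert b G"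
        using AS by (intro nested_isLub[OF S _ _ _ _ antiA, where x = b and y = a]) auto
      then show thesis
        using that by blast
    qed
    have fq: "factors (insert b G) q = insert b A"
      using factors_join_nested_antichain[OF Gb S _ _ antiA q] AS by blast
    have "t \<le> q" if "t \<in> T" for t
      using q that order.trans unfolding isLub_UNIV_iff A_def by blast
    then obtain j where j: "isLub UNIV T j" "j \<le> q"
      using ex_isLub_bounded[of T q] by (auto simp: isLub_UNIV_iff)
    have Tj: "t \<le> j" if "t \<in> T" for t
      using j that by (simp add: isLub_UNIV_iff)
    have single: False if g: "g \<in> T" "j \<le> g" for g
    proof -
      have "T \<subseteq> {g}"
        using anti[OF _ g(1)] Tj g order.trans by blast
      then have "card T \<le> 1"
        using card_mono[of "{g}" T] by simp
      then show False
        using T by simp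
    qed
    have "j \<notin> G"
    proof
      assume jG: "j \<in> G"
      obtain g where g: "g \<in> insert b A" "j \<le> g"
        using le_factor[of j "insert b G" q] j jG fq by blast
      have "g \<notin> T"
        using single g by blast
      then have "j \<le> b"
        using g unfolding A_def by blast
      \<comment> \<open>Since \<open>j\<close> is in \<open>G\<close>, it lies below a factor of
        \<open>b\<close>. That factor is above \<open>f\<close>, hence equal to it, so
        \<open>f \<in> T\<close> bounds \<open>j\<close>.\<close>
      then obtain h where h: "h \<in> F" "j \<le> h"
        using le_factor[of j G b] jG unfolding F_def by blast
      then have "f = h"
        using factors_antichain[of f G b h] f Tj order.trans unfolding F_def by blast
      then show False
        using single f h by blast
    qed
    then show ?thesis
      using j by blast
  qed
qed

text \<open>In an antichain containing \<open>b\<close>, the element \<open>b\<close> can be traded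
  for its factors without changing the upper bounds. After dropping the redundant factors this is an
  antichain in \<open>S \<union> F\<close>, so its join \<open>q\<close> exists and has exactly this
  antichain as its factors.\<close>

lemma nested_insert_new:
  assumes "b \<notin> S" and S: "S \<union> F \<in> nested_set_complex G" and "\<not> F \<subseteq> S"
  shows "insert b S \<in> nested_set_complex (insert b G)"
proof (rule nested_setI)
  show "insert b S \<subseteq> insert b G"
    using nested_set_subset[OF S] by blast
  fix T assume TS: "T \<subseteq> insert b S" and T: "2 \<le> card T"
    and anti: "\<And>x y. x \<in> T \<Longrightarrow> y \<in> T \<Longrightarrow> x \<le> y \<Longrightarrow> x = y"
  show "\<exists>j. isLub UNIV T j \<and> j \<notin> insert b G"
  proof (cases "b \<in> T")
    case False
    have Sb: "S \<in> nested_set_complex (insert b G)"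
      using nested_insert_old nested_subset[OF S] assms by blast
    have "T \<subseteq> S"
      using TS False by blast
    then show ?thesis
      by (rule nested_setD[OF Sb _ T anti])
  next
    case True
    have "T \<noteq> {b}"
      using T by auto
    then obtain a where a: "a \<in> T" "a \<noteq> b"
      using True by blast
    define A where "A = T - {b}"
    have AS: "A \<subseteq> S"
      using TS by (auto simp: A_def)
    have Ab: "\<not> x \<le> b" "\<not> b \<le> x" if "x \<in> A" for x
      using that anti True unfolding A_def by blast+
    \<comment> \<open>the maximal elements of \<open>A \<union> F\<close>, a set with the same upper bounds as \<open>T\<close>\<close>
    define T' where "T' = A \<union> {f \<in> F. \<forall>x\<in>A. \<not> f \<le> x}"
    have T'S: "T' \<subseteq> S \<union> F"
      using AS by (auto simp: T'_def)
    have aT': "a \<in> T'" "a \<in> A"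
      using a by (auto simp: T'_def A_def)
    have anti': "x = y" if xy: "x \<in> T'" "y \<in> T'" "x \<le> y" for x y
    proof -
      have "False" if "x \<in> A" "y \<in> F"
        using Ab(1)[OF that(1)] xy(3) that(2) factorsD(2) order.trans unfolding F_def by blast
      then show ?thesis
        using xy anti factors_antichain unfolding T'_def A_def F_def by blast
    qed
    have ub: "(\<forall>t\<in>T'. t \<le> u) \<longleftrightarrow> (\<forall>t\<in>T. t \<le> u)" for u
    proof
      assume u: "\<forall>t\<in>T'. t \<le> u"
      have "f \<le> u" if "f \<in> F" for f
        using u that order.trans unfolding T'_def by blast
      then have "b \<le> u"
        using isLub_factors_new by (simp add: isLub_UNIV_iff)
      then show "\<forall>t\<in>T. t \<le> u"
        using u unfolding T'_def A_def by blast
    next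
      assume u: "\<forall>t\<in>T. t \<le> u"
      then have "f \<le> u" if "f \<in> F" for f
        using True that factorsD order.trans unfolding F_def by blast
      then show "\<forall>t\<in>T'. t \<le> u"
        using u unfolding T'_def A_def by blast
    qed
    obtain q where q: "isLub UNIV T' q"
    proof (cases "T' = {a}")
      case True
      then show thesis
        using that[of a] by (simp add: isLub_UNIV_iff)
    next
      case False
      then obtain c where "c \<in> T'" "c \<noteq> a"
        using aT' by blast
      then have "\<exists>j. isLub UNIV T' j \<and> j \<notin> G"
        by (intro nested_isLub[OF S T'S _ aT'(1) _ anti'])
      then show thesis
        using that by blast
    qed
    then have qT: "isLub UNIV T q"
      unfolding isLub_UNIV_iff ub .
    have fq: "factors G q = T'"
      using factors_join_nested_antichain[OF G S T'S _ anti' q] aT' by blast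
    have "q \<notin> G"
    proof
      \<comment> \<open>An element of \<open>G\<close> is its own only factor, so the antichain
        would be \<open>{a}\<close> and \<open>b \<le> q = a\<close>, although \<open>a\<close> and
        \<open>b\<close> are incomparable.\<close>
      assume "q \<in> G"
      then have "q = a"
        using factors_single[of q G] fq aT'(1) by simp
      then show False
        using qT True Ab(2)[OF aT'(2)] by (auto simp: isLub_UNIV_iff)
    qed
    moreover have "q \<noteq> b"
      using qT a Ab(1)[OF aT'(2)] by (auto simp: isLub_UNIV_iff)
    ultimately show ?thesis
      using qT by blast
  qed
qed

lemma nested_set_complex_insert:
  "nested_set_complex (insert b G) = stellar_subdivision F b (nested_set_complex G)"
proof (rule set_eqI)
  fix S
  have new: "\<forall>S\<in>nested_set_complex G. b \<notin> S"
    using nested_set_subset bG by blast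
  have down: "\<forall>S\<in>nested_set_complex G. \<forall>T\<subseteq>S. T \<in> nested_set_complex G"
    using nested_subset by blast
  have bF: "b \<notin> F"
    using bG factorsD unfolding F_def by blast
  show "S \<in> nested_set_complex (insert b G) \<longleftrightarrow>
    S \<in> stellar_subdivision F b (nested_set_complex G)"
  proof (cases "b \<in> S")
    case False
    then show ?thesis
      using nested_insert_old by (auto simp: stellar_subdivision_def)
  next
    case True
    define R where "R = S - {b}"
    have R: "S = insert b R" "b \<notin> R"
      using True by (auto simp: R_def)
    \<comment> \<open>\<open>R\<close> is again nested for \<open>insert b G\<close> and avoids
      \<open>b\<close>, so the criterion for sets without \<open>b\<close> applies to it.\<close>
    have "\<not> F \<subseteq> R" if "S \<in> nested_set_complex (insert b G)"
      using nested_insert_old[OF R(2)] nested_subset[OF that, of R] R by blast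
    then show ?thesis
      using insert_in_stellar_subdivision[OF down new bF R(2)]
        nested_union_factors[OF R(2)] nested_insert_new[OF R(2)] R(1) by blast
  qed
qed

end

section \<open>The three equations for the facet count\<close>

theorem theorem4:
  shows "N_function (chi :: 'a::{finite, semilattice_inf, order_bot} set \<Rightarrow> 'a set \<Rightarrow> nat)"
proof -
  have "(b \<notin> S \<and> S \<union> F \<notin> nested_set_complex G \<longrightarrow> chi (G \<union> {b}) S = chi G S) \<and>
      (b \<notin> S \<and> S \<union> F \<in> nested_set_complex G \<longrightarrow>
        int (chi (G \<union> {b}) S) = int (chi G S) + int (chi G (S \<union> F)) * (int (card (F - S)) - 1)) \<and>
      (b \<in> S \<longrightarrow> chi (G \<union> {b}) S = chi G (S - {b} \<union> F) * card (F - S))"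
    if G: "building_set G" "building_set (G \<union> {b})" and bG: "b \<notin> G" and F: "F = factors G b"
    for G :: "'a set" and b S F
  proof -
    let ?K = "nested_set_complex G"
    let ?f = "maximal_elements (stellar_subdivision F b ?K)"
    have new: "\<forall>S\<in>?K. b \<notin> S"
      using nested_set_subset bG by blast
    have down: "\<forall>S\<in>?K. \<forall>T\<subseteq>S. T \<in> ?K"
      using nested_subset by blast
    have bF: "b \<notin> F"
      using bG factorsD unfolding F by blast
    have K': "nested_set_complex (G \<union> {b}) = stellar_subdivision F b ?K"
      using nested_set_complex_insert[of G b] G bG F by simp
    have chi1: "chi G R = card {M \<in> maximal_elements ?K. R \<subseteq> M}" for R
      by (simp add: chi_def maximal_elements_superset)
    have chi2: "chi (G \<union> {b}) R = card {M \<in> ?f. R \<subseteq> M}" for R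
      unfolding chi_def K' maximal_elements_superset ..
    note new_facets = card_new_facets[OF down new bF]
    note old_facets = card_old_facets[OF down new bF]
    show ?thesis
    proof (cases "b \<in> S")
      case True
      \<comment> \<open>All facets above \<open>S\<close> contain \<open>b\<close>, so only new
        facets are counted; their count is available for base sets without \<open>b\<close>.\<close>
      have "{M \<in> ?f. S \<subseteq> M} = {M \<in> ?f. b \<in> M \<and> S - {b} \<subseteq> M}"
        using True by blast
      moreover have "F - (S - {b}) = F - S"
        using bF by blast
      ultimately have "chi (G \<union> {b}) S = chi G (S - {b} \<union> F) * card (F - S)"
        using new_facets[of "S - {b}"] unfolding chi1 chi2 by simp
      then show ?thesis
        using True by blast
    next
      case False
      have "{M \<in> ?f. S \<subseteq> M} = {M \<in> ?f. b \<notin> M \<and> S \<subseteq> M} \<union> {M \<in> ?f. b \<in> M \<and> S \<subseteq> M}"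
        by blast
      moreover have "{M \<in> ?f. b \<notin> M \<and> S \<subseteq> M} \<inter> {M \<in> ?f. b \<in> M \<and> S \<subseteq> M} = {}"
        by blast
      ultimately have "chi (G \<union> {b}) S =
          card {M \<in> ?f. b \<notin> M \<and> S \<subseteq> M} + card {M \<in> ?f. b \<in> M \<and> S \<subseteq> M}"
        unfolding chi2 by (simp add: card_Un_disjoint)
      \<comment> \<open>The old facets number \<open>chi G S\<close> less
        \<open>chi G (S \<union> F)\<close>, the new ones
        \<open>chi G (S \<union> F) * card (F - S)\<close>. The subtracted term is moved to the left
        to stay in the natural numbers.\<close>
      then have count: "chi (G \<union> {b}) S + chi G (S \<union> F) = chi G S + chi G (S \<union> F) * card (F - S)"
        using new_facets[OF False] old_facets[OF False] unfolding chi1 by linarith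
      \<comment> \<open>A facet above \<open>S \<union> F\<close> would make
        \<open>S \<union> F\<close> nested. With this term zero, the first equation becomes a
        special case of \<open>count\<close>.\<close>
      have "chi G (S \<union> F) = 0" if "S \<union> F \<notin> ?K"
      proof -
        have "{M \<in> maximal_elements ?K. S \<union> F \<subseteq> M} = {}"
          using that nested_subset[of _ G "S \<union> F"] by (auto simp: maximal_elements_def)
        then show ?thesis
          unfolding chi1 by (simp only: card.empty)
      qed
      then have "chi (G \<union> {b}) S = chi G S" if "S \<union> F \<notin> ?K"
        using count that by simp
      moreover have "int (chi (G \<union> {b}) S) =
          int (chi G S) + int (chi G (S \<union> F)) * (int (card (F - S)) - 1)"
        using arg_cong[OF count, of int] by (simp add: algebra_simps)
      ultimately show ?thesis
        using False by blast
    qed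
  qed
  then show ?thesis
    unfolding N_function_def Let_def by blast
qed

end
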